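(* The density of GSE, $p_{GSE,n,\sigma^2}$, satisfies the differential equation $$4\sigma^4 p_{GSE,n,\sigma^2}'''(x) + \bigl(\sigma^2(8n+2)- x^2\bigr)p_{GSE,n,\sigma^2}'(x) - 2x\, p_{GSE,n,\sigma^2}(x) = -3\sigma^2 p_{GUE,n,\sigma^2}'(x)-3x\, p_{GUE,n,\sigma^2}(x).$$
   Context: Here $n\ge 1$ is an integer and $\sigma>0$. The Hermite polynomials are $H_k(x)=(-1)^k e^{x^2}\frac{d^k}{dx^k}e^{-x^2}$ and the Hermite functions are $\phi_k(x)=\frac{1}{\sqrt{2^k k!\sqrt{\pi}}}H_k(x)e^{-x^2/2}$, $k\ge 0$. For an integer $m\ge 1$ and $\sigma>0$, $$p_{GUE,m,\sigma^2}(x)=\frac{1}{\sigma\sqrt2}\sum_{k=0}^{m-1}\phi_k\Bigl(\frac{x}{\sigma\sqrt2}\Bigr)^2,\qquad \tau_m(x)=\sqrt{\frac m2}\,\phi_{m-1}(x)\,\frac12\int_{\mathbb{R}}\operatorname{sign}(x-t)\phi_m(t)\,dt,$$ $$p_{GSE,n,\sigma^2}(x)=p_{GUE,2n+1,\sigma^2}(x)+\frac{1}{\sigma\sqrt2}\,\tau_{2n+1}\Bigl(\frac{x}{\sigma\sqrt2}\Bigr).$$ These are the formulas taken for the mean eigenvalue density functions of the Gaussian Unitary Ensemble (GUE) and the Gaussian Symplectic Ensemble (GSE).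
   Formalization: The right-hand side uses the GUE density with index 2n+1 instead of the printed index n; as printed the equation is false (for n=1, σ²=1/2 the left side is -12x³e^{-x²}/√π while the right side is 0). *)

theory Defs
  imports "HOL-Analysis.Analysis"
begin

definition hermite :: "nat \<Rightarrow> real \<Rightarrow> real" where
  "hermite k x = (-1) ^ k * exp (x\<^sup>2) * (deriv ^^ k) (\<lambda>t. exp (- t\<^sup>2)) x"

definition hermite_fun :: "nat \<Rightarrow> real \<Rightarrow> real" where
  "hermite_fun k x = 1 / sqrt (2 ^ k * fact k * sqrt pi) * hermite k x * exp (- x\<^sup>2 / 2)"

(* The densities take the standard deviation \<sigma> as argument, not the variance \<sigma>^2 that usually
   indexes them. *)
definition p_GUE :: "nat \<Rightarrow> real \<Rightarrow> real \<Rightarrow> real" where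
  "p_GUE m \<sigma> x = 1 / (\<sigma> * sqrt 2) * (\<Sum>k<m. (hermite_fun k (x / (\<sigma> * sqrt 2)))\<^sup>2)"

(* Intended for m \<ge> 1, so that m - 1 is not truncated. *)
definition tau :: "nat \<Rightarrow> real \<Rightarrow> real" where
  "tau m x = sqrt (real m / 2) * hermite_fun (m - 1) x
     * (1 / 2 * (LBINT t. sgn (x - t) * hermite_fun m t))"

(* The summand p_GUE has index 2 * n + 1. The differential equation relating the two densities holds
   with this same index on its inhomogeneous side, not with index n: for n = 1 one has
   p_GSE 1 \<sigma> = (\<lambda>x. 2 * p_GUE 1 \<sigma> x), and - 3 * \<sigma>^2 * p_GUE' - 3 * x * p_GUE
   vanishes for p_GUE = p_GUE 1 \<sigma>, whereas the homogeneous side does not. *)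
definition p_GSE :: "nat \<Rightarrow> real \<Rightarrow> real \<Rightarrow> real" where
  "p_GSE n \<sigma> x = p_GUE (2 * n + 1) \<sigma> x
     + 1 / (\<sigma> * sqrt 2) * tau (2 * n + 1) (x / (\<sigma> * sqrt 2))"

end

theory Submission
  imports Defs "HOL-Probability.Distributions"
begin

text \<open>
  In the variable \<open>u = x / (\<sigma> \<surd>2)\<close> write \<open>m = 2 n + 1\<close>, \<open>a = \<surd>(m / 2)\<close>,
  \<open>\<phi> = \<phi>\<^sub>m\<^sub>-\<^sub>1\<close>, \<open>\<psi> = \<phi>\<^sub>m\<close> and let \<open>E\<close> be the sign transform of \<open>\<psi>\<close>. The pair
  \<open>(\<phi>, \<psi>)\<close> solves the linear system \<open>\<phi>' = u \<phi> - 2 a \<psi>\<close>, \<open>\<psi>' = 2 a \<phi> - u \<psi>\<close>, and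
  \<open>E' = \<psi>\<close>. By Christoffel--Darboux the GUE density \<open>G\<close> is the quadratic form
  \<open>2 a\<^sup>2 (\<phi>\<^sup>2 + \<psi>\<^sup>2) - 2 a u \<phi> \<psi>\<close>, with \<open>G' = - 2 a \<phi> \<psi>\<close>. Hence every term of the equation is a
  polynomial expression in \<open>u, \<phi>, \<psi>, E, a\<close>, and the claim is an identity between such polynomials.
\<close>

section \<open>Hermite polynomials and the Rodrigues formula\<close>

fun hermite_poly :: "nat \<Rightarrow> real poly" where
  "hermite_poly 0 = 1"
| "hermite_poly (Suc k) = [:0, 2:] * hermite_poly k - pderiv (hermite_poly k)"

text \<open>Differentiating the defining recursion and applying the induction hypothesis twice
  leaves that same recursion inside the bracket.\<close>

lemma pderiv_hermite_poly_Suc: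
  "pderiv (hermite_poly (Suc k)) = smult (2 * real (Suc k)) (hermite_poly k)"
proof (induction k)
  case 0
  show ?case by (simp add: pderiv_pCons pderiv_1)
next
  case (Suc k)
  have "pderiv (hermite_poly (Suc (Suc k)))
      = smult 2 (hermite_poly (Suc k)) + [:0, 2:] * pderiv (hermite_poly (Suc k))
        - pderiv (pderiv (hermite_poly (Suc k)))"
    by (simp only: hermite_poly.simps(2)[of "Suc k"] pderiv_diff pderiv_mult)
       (simp add: pderiv_pCons)
  also have "\<dots> = smult 2 (hermite_poly (Suc k))
      + smult (2 * real (Suc k)) ([:0, 2:] * hermite_poly k - pderiv (hermite_poly k))"
    unfolding Suc.IH by (simp add: pderiv_smult smult_diff_right)
  also have "\<dots> = smult (2 + 2 * real (Suc k)) (hermite_poly (Suc k))"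
    by (simp only: hermite_poly.simps(2)[symmetric] smult_add_left)
  finally show ?case by (simp add: algebra_simps)
qed

lemma poly_hermite_poly_Suc_Suc:
  "poly (hermite_poly (Suc (Suc k))) x
     = 2 * x * poly (hermite_poly (Suc k)) x - 2 * real (Suc k) * poly (hermite_poly k) x"
  by (simp only: hermite_poly.simps(2)[of "Suc k"] pderiv_hermite_poly_Suc) simp

text \<open>Differentiating \<open>p * exp (- x\<^sup>2)\<close> replaces \<open>p\<close> by
  \<open>- (2 * x * p - p')\<close>; the recursion of \<open>hermite_poly\<close> is chosen to match
  this.\<close>

lemma higher_deriv_gaussian:
  "(deriv ^^ k) (\<lambda>t::real. exp (- t\<^sup>2))
     = (\<lambda>x. (-1) ^ k * poly (hermite_poly k) x * exp (- x\<^sup>2))"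
proof (induction k)
  case 0
  show ?case by simp
next
  case (Suc k)
  have "((\<lambda>x. (-1) ^ k * poly (hermite_poly k) x * exp (- x\<^sup>2)) has_real_derivative
      (-1) ^ Suc k * poly (hermite_poly (Suc k)) x * exp (- x\<^sup>2)) (at x)" for x :: real
    by (auto intro!: derivative_eq_intros poly_DERIV simp: algebra_simps)
  then show ?case
    unfolding funpow.simps o_def Suc.IH by (intro ext DERIV_imp_deriv)
qed

lemma hermite_eq_poly: "hermite k x = poly (hermite_poly k) x"
proof -
  have "hermite k x
      = ((-1) ^ k * (-1) ^ k) * (exp (x\<^sup>2) * exp (- x\<^sup>2)) * poly (hermite_poly k) x"
    unfolding hermite_def higher_deriv_gaussian by (simp only: mult_ac)
  also have "\<dots> = poly (hermite_poly k) x"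
    by (simp add: power_mult_distrib[symmetric] exp_add[symmetric])
  finally show ?thesis .
qed

section \<open>Hermite functions: first-order relations and sums of squares\<close>

definition hermite_norm :: "nat \<Rightarrow> real" where
  "hermite_norm k = sqrt (2 ^ k * fact k * sqrt pi)"

lemma hermite_norm_pos: "hermite_norm k > 0"
  by (simp add: hermite_norm_def)

lemma hermite_norm_Suc: "hermite_norm (Suc k) = sqrt (2 * real (Suc k)) * hermite_norm k"
  unfolding hermite_norm_def real_sqrt_mult[symmetric] by (simp add: algebra_simps)

lemma hermite_fun_eq:
  "hermite_fun k x = poly (hermite_poly k) x * exp (- x\<^sup>2 / 2) / hermite_norm k"
  by (simp add: hermite_fun_def hermite_eq_poly hermite_norm_def)

text \<open>The raising relation. Only the index above \<open>k\<close> occurs, so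
  \<open>k = 0\<close> needs no special case.\<close>

lemma has_derivative_hermite_fun:
  "(hermite_fun k has_real_derivative
     x * hermite_fun k x - sqrt (2 * real (Suc k)) * hermite_fun (Suc k) x) (at x)"
proof -
  have "hermite_norm k \<noteq> 0" "sqrt (2 * real (Suc k)) \<noteq> 0"
    using hermite_norm_pos[of k] by auto
  then have "x * hermite_fun k x - sqrt (2 * real (Suc k)) * hermite_fun (Suc k) x
      = (poly (pderiv (hermite_poly k)) x - x * poly (hermite_poly k) x)
          * exp (- x\<^sup>2 / 2) / hermite_norm k"
    unfolding hermite_fun_eq hermite_norm_Suc hermite_poly.simps
    by (simp add: field_simps del: real_sqrt_mult of_nat_Suc)
  moreover have "((\<lambda>x. poly (hermite_poly k) x * exp (- x\<^sup>2 / 2) / hermite_norm k)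
      has_real_derivative (poly (pderiv (hermite_poly k)) x - x * poly (hermite_poly k) x)
          * exp (- x\<^sup>2 / 2) / hermite_norm k) (at x)"
  proof -
    have "((\<lambda>x. poly (hermite_poly k) x * exp (- x\<^sup>2 / 2)) has_real_derivative
        (poly (pderiv (hermite_poly k)) x - x * poly (hermite_poly k) x) * exp (- x\<^sup>2 / 2)) (at x)"
      by (auto intro!: derivative_eq_intros poly_DERIV simp: algebra_simps)
    then show ?thesis by (rule DERIV_cdivide)
  qed
  ultimately show ?thesis
    by (simp only: hermite_fun_eq[abs_def])
qed

lemma hermite_fun_Suc_Suc:
  "sqrt (2 * real (Suc (Suc k))) * hermite_fun (Suc (Suc k)) x
     = 2 * x * hermite_fun (Suc k) x - sqrt (2 * real (Suc k)) * hermite_fun k x"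
proof -
  define r s N where "r = sqrt (2 * real (Suc k))" and "s = sqrt (2 * real (Suc (Suc k)))"
    and "N = hermite_norm k"
  have nz: "r \<noteq> 0" "s \<noteq> 0" "N \<noteq> 0" and r2: "2 * real (Suc k) = r * r"
    using hermite_norm_pos[of k] by (auto simp: r_def s_def N_def)
  show ?thesis
    unfolding hermite_fun_eq poly_hermite_poly_Suc_Suc hermite_norm_Suc
      r_def[symmetric] s_def[symmetric] N_def[symmetric] r2
    using nz by (simp add: field_simps del: hermite_poly.simps)
qed

text \<open>The lowering relation: the raising relation with its top index eliminated by the
  three-term recurrence.\<close>

lemma has_derivative_hermite_fun_Suc:
  "(hermite_fun (Suc k) has_real_derivative
     sqrt (2 * real (Suc k)) * hermite_fun k x - x * hermite_fun (Suc k) x) (at x)"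
  using has_derivative_hermite_fun[of "Suc k" x]
  unfolding hermite_fun_Suc_Suc by (simp add: algebra_simps)

text \<open>The Christoffel-Darboux formula on the diagonal, with the derivatives eliminated by the
  raising and lowering relations.\<close>

lemma christoffel_darboux_hermite_fun:
  fixes x :: real
  defines "r \<equiv> \<lambda>k. sqrt (2 * real (Suc k))"
  shows "2 * (\<Sum>k<Suc j. (hermite_fun k x)\<^sup>2)
     = (r j)\<^sup>2 * ((hermite_fun j x)\<^sup>2 + (hermite_fun (Suc j) x)\<^sup>2)
       - 2 * r j * x * hermite_fun j x * hermite_fun (Suc j) x"
proof (induction j)
  case 0
  have "r 0 * hermite_fun (Suc 0) x = 2 * x * hermite_fun 0 x" "(r 0)\<^sup>2 = 2"
    using hermite_norm_pos[of 0]
    by (simp_all add: r_def hermite_fun_eq hermite_norm_Suc field_simps pderiv_1)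
  then show ?case
    by simp algebra
next
  case (Suc j)
  define f g h where "f = hermite_fun j x" and "g = hermite_fun (Suc j) x"
    and "h = hermite_fun (Suc (Suc j)) x"
  have rec: "r (Suc j) * h = 2 * x * g - r j * f"
    unfolding r_def f_def g_def h_def by (rule hermite_fun_Suc_Suc)
  have r2: "(r (Suc j))\<^sup>2 = (r j)\<^sup>2 + 2"
    by (simp add: r_def)
  have "2 * (\<Sum>k<Suc (Suc j). (hermite_fun k x)\<^sup>2)
      = (r j)\<^sup>2 * (f\<^sup>2 + g\<^sup>2) - 2 * r j * x * f * g + 2 * g\<^sup>2"
    using Suc.IH by (simp add: f_def g_def)
  \<comment> \<open>\<open>h\<close> enters only through the product \<open>r (Suc j) * h\<close>,
    which \<open>rec\<close> expresses by \<open>f\<close> and \<open>g\<close>.\<close>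
  also have "\<dots> = (r (Suc j))\<^sup>2 * (g\<^sup>2 + h\<^sup>2) - 2 * r (Suc j) * x * g * h"
    using rec r2 by algebra
  finally show ?case
    unfolding f_def g_def h_def .
qed

text \<open>The sum telescopes: adding the raising and lowering relations makes the derivative of
  each square a difference of consecutive terms of the form on the right.\<close>

lemma has_derivative_sum_hermite_fun_squared:
  "((\<lambda>x. \<Sum>k<Suc j. (hermite_fun k x)\<^sup>2) has_real_derivative
     - sqrt (2 * real (Suc j)) * hermite_fun j x * hermite_fun (Suc j) x) (at x)"
proof (induction j)
  case 0
  have "sqrt 2 * hermite_fun (Suc 0) x = 2 * x * hermite_fun 0 x"
    using hermite_norm_pos[of 0]
    by (simp add: hermite_fun_eq hermite_norm_Suc field_simps pderiv_1)
  then show ?case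
    using has_derivative_hermite_fun[of 0 x]
    by (auto intro!: derivative_eq_intros simp: algebra_simps power2_eq_square)
next
  case (Suc j)
  \<comment> \<open>Removes index \<open>Suc (Suc j)\<close> from the target, so that the lowering
    relation suffices.\<close>
  have eq: "- sqrt (2 * real (Suc (Suc j))) * hermite_fun (Suc j) x * hermite_fun (Suc (Suc j)) x
      = - hermite_fun (Suc j) x
          * (2 * x * hermite_fun (Suc j) x - sqrt (2 * real (Suc j)) * hermite_fun j x)"
    unfolding hermite_fun_Suc_Suc[symmetric] by (simp add: mult_ac)
  show ?case
    unfolding sum.lessThan_Suc[of _ "Suc j"] eq
    by (rule derivative_eq_intros Suc.IH has_derivative_hermite_fun_Suc refl)+
       (simp add: algebra_simps power2_eq_square)
qed

section \<open>Integrability and the sign transform\<close>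

lemma integrable_poly_gaussian:
  fixes p :: "real poly"
  shows "integrable lborel (\<lambda>t. poly p t * exp (- t\<^sup>2 / 2))"
proof -
  have mon: "integrable lborel (\<lambda>t::real. c * t ^ i * exp (- t\<^sup>2 / 2))" for c :: real and i
  proof -
    have "(\<lambda>t::real. c * t ^ i * exp (- t\<^sup>2 / 2))
        = (\<lambda>t. c * sqrt (2 * pi) * (std_normal_density t * t ^ i))"
      by (simp add: std_normal_density_def fun_eq_iff)
    then show ?thesis
      using integrable_std_normal_moment[of i] by simp
  qed
  show ?thesis
    unfolding poly_altdef sum_distrib_right by (intro Bochner_Integration.integrable_sum mon)
qed

lemma integrable_hermite_fun: "integrable lborel (hermite_fun k)"
  unfolding hermite_fun_eq[abs_def] using integrable_poly_gaussian by simp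

text \<open>Moving \<open>x\<close> from \<open>a\<close> to \<open>y\<close> raises
  \<open>1 / 2 * sgn (x - t)\<close> by one strictly between them and leaves it unchanged outside,
  so the transform is a primitive of \<open>f\<close>.\<close>

lemma has_derivative_sgn_transform:
  fixes f :: "real \<Rightarrow> real"
  assumes int: "integrable lborel f" and cont: "continuous_on UNIV f"
  shows "((\<lambda>x. 1 / 2 * (LBINT t. sgn (x - t) * f t)) has_real_derivative f x) (at x)"
proof -
  define F where "F = (\<lambda>x. 1 / 2 * (LBINT t. sgn (x - t) * f t))"
  have int_sgn: "integrable lborel (\<lambda>t. sgn (y - t) * f t)" for y
    by (rule Bochner_Integration.integrable_bound[OF int])
       (use int in \<open>auto simp: abs_mult sgn_if\<close>)
  have F_eq: "F y = F a + integral {a..y} f" if "a \<le> y" for a y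
  proof -
    have "F y - F a = (LBINT t. 1 / 2 * (sgn (y - t) * f t - sgn (a - t) * f t))"
      unfolding F_def by (simp add: int_sgn right_diff_distrib)
    also have "\<dots> = (LBINT t. indicator {a..y} t *\<^sub>R f t)"
    proof (rule integral_cong_AE)
      show "AE t in lborel. 1 / 2 * (sgn (y - t) * f t - sgn (a - t) * f t)
          = indicator {a..y} t *\<^sub>R f t"
        \<comment> \<open>At the endpoints \<open>sgn\<close> vanishes and the integrands may
          differ; both points are null sets.\<close>
        using AE_lborel_singleton[of a] AE_lborel_singleton[of y]
        by eventually_elim (use that in \<open>auto simp: sgn_if indicator_def\<close>)
    qed (use int int_sgn in \<open>auto simp: borel_measurable_integrable\<close>)
    also have "\<dots> = integral {a..y} f"
      unfolding set_lebesgue_integral_def[symmetric]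
      by (rule set_borel_integral_eq_integral(2))
         (use integrable_mult_indicator[OF _ int, of "{a..y}"] in \<open>simp add: set_integrable_def\<close>)
    finally show ?thesis by simp
  qed
  \<comment> \<open>The base point \<open>x - 1\<close> lies to the left of \<open>x\<close>, so
    \<open>F_eq\<close> applies on a whole neighbourhood of \<open>x\<close>.\<close>
  have "((\<lambda>y. integral {x - 1..y} f) has_real_derivative f x) (at x within {x - 1..x + 1})"
    by (rule integral_has_real_derivative) (auto intro: continuous_on_subset[OF cont])
  then have "((\<lambda>y. F (x - 1) + integral {x - 1..y} f) has_real_derivative f x) (at x)"
    using at_within_interior[of x "{x - 1..x + 1}"] by (auto intro!: derivative_eq_intros)
  then have "(F has_real_derivative f x) (at x)"
    by (rule has_field_derivative_transform_within_open[of _ _ _ "{x - 1<..}"])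
       (auto intro: F_eq[symmetric])
  then show ?thesis by (simp add: F_def)
qed

section \<open>Rescaling and the differential equation\<close>

lemma has_derivative_scaled:
  fixes f :: "real \<Rightarrow> real"
  assumes "\<And>u. (f has_real_derivative g u) (at u)"
  shows "((\<lambda>x. A * f (x / s)) has_real_derivative A / s * g (x / s)) (at x)"
proof -
  have "((\<lambda>x. x / s) has_real_derivative 1 / s) (at x)"
    using DERIV_cdivide[OF DERIV_ident] .
  from DERIV_cmult[OF DERIV_chain2[OF assms this], of A] show ?thesis
    by simp
qed

text \<open>Since \<open>deriv\<close> is total, the differentiability conjuncts ensure that every
  \<open>deriv\<close> in the equation is a genuine derivative.\<close>

theorem proposition1p3:
  fixes n :: nat and \<sigma> x :: real
  assumes "n \<ge> 1" and "\<sigma> > 0"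
  shows "(\<forall>k<3. (deriv ^^ k) (p_GSE n \<sigma>) differentiable (at x)) \<and>
         p_GUE (2 * n + 1) \<sigma> differentiable (at x) \<and>
         4 * \<sigma> ^ 4 * (deriv ^^ 3) (p_GSE n \<sigma>) x
           + (\<sigma>\<^sup>2 * (8 * real n + 2) - x\<^sup>2) * deriv (p_GSE n \<sigma>) x
           - 2 * x * p_GSE n \<sigma> x
         = - 3 * \<sigma>\<^sup>2 * deriv (p_GUE (2 * n + 1) \<sigma>) x
           - 3 * x * p_GUE (2 * n + 1) \<sigma> x"
proof -
  define s where "s = \<sigma> * sqrt 2"
  \<comment> \<open>\<open>r\<close> is \<open>2 * a\<close> in the notation of the overview; the
    factor in \<open>tau\<close> is therefore \<open>r / 2\<close>.\<close>
  define r where "r = sqrt (2 * real (Suc (2 * n)))"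
  define f where "f = hermite_fun (2 * n)"
  define g where "g = hermite_fun (Suc (2 * n))"
  define E where "E = (\<lambda>u. 1 / 2 * (LBINT t. sgn (u - t) * g t))"
  define G where "G = (\<lambda>u. \<Sum>k<Suc (2 * n). (hermite_fun k u)\<^sup>2)"
  define S where "S = (\<lambda>u. G u + r / 2 * f u * E u)"
  \<comment> \<open>The successive derivatives of \<open>S\<close>, simplified by
    \<open>f'' = (u\<^sup>2 + 1 - r\<^sup>2) * f\<close> and
    \<open>g'' = (u\<^sup>2 - 1 - r\<^sup>2) * g\<close>; the latter two give the term
    \<open>2 * f u * g u\<close> in \<open>S3\<close>.\<close>
  define S1 where "S1 = (\<lambda>u. r / 2 * ((u * f u - r * g u) * E u - f u * g u))"
  define S2 where "S2 = (\<lambda>u. r / 2 * ((u\<^sup>2 + 1 - r\<^sup>2) * f u * E u - f u * (r * f u - u * g u)))"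
  define S3 where "S3 = (\<lambda>u. r / 2 *
    (2 * u * f u * E u + (u\<^sup>2 + 1 - r\<^sup>2) * (u * f u - r * g u) * E u + 2 * f u * g u
      - (u * f u - r * g u) * (r * f u - u * g u)))"
  have s: "s \<noteq> 0" "s\<^sup>2 = 2 * \<sigma>\<^sup>2"
    using assms by (auto simp: s_def power_mult_distrib)
  have r: "r\<^sup>2 = 4 * real n + 2"
    by (simp add: r_def)
  have "sqrt (real (Suc (2 * n)) / 2) = sqrt ((r / 2)\<^sup>2)"
    by (simp add: r power_divide)
  also have "\<dots> = r / 2"
    unfolding real_sqrt_abs by (simp add: r_def)
  finally have sqrt_r: "sqrt (real (Suc (2 * n)) / 2) = r / 2" .
  have df: "(f has_real_derivative u * f u - r * g u) (at u)"
    and dg: "(g has_real_derivative r * f u - u * g u) (at u)"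
    and dG: "(G has_real_derivative - r * f u * g u) (at u)" for u
    unfolding f_def g_def r_def G_def
    by (rule has_derivative_hermite_fun has_derivative_hermite_fun_Suc
          has_derivative_sum_hermite_fun_squared)+
  have dE: "(E has_real_derivative g u) (at u)" for u
    unfolding E_def
    by (rule has_derivative_sgn_transform)
       (auto simp: g_def integrable_hermite_fun
         intro: DERIV_continuous_on has_field_derivative_at_within has_derivative_hermite_fun)
  have dS: "(S has_real_derivative S1 u) (at u)" for u
    unfolding S_def
    by (rule derivative_eq_intros df dg dE dG refl)+ (simp add: S1_def field_simps)
  have dS1: "(S1 has_real_derivative S2 u) (at u)" for u
    unfolding S1_def
    by (rule derivative_eq_intros df dg dE refl)+
       (simp add: S2_def algebra_simps power2_eq_square)
  have dS2: "(S2 has_real_derivative S3 u) (at u)" for u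
    unfolding S2_def
    by (rule derivative_eq_intros df dg dE refl)+
       (simp add: S3_def field_simps power2_eq_square)
  have GUE: "p_GUE (2 * n + 1) \<sigma> = (\<lambda>x. 1 / s * G (x / s))"
    by (simp add: p_GUE_def G_def s_def fun_eq_iff)
  have tau: "tau (2 * n + 1) u = r / 2 * f u * E u" for u
    unfolding Suc_eq_plus1[symmetric] tau_def sqrt_r E_def f_def g_def diff_Suc_1 ..
  have GSE: "p_GSE n \<sigma> = (\<lambda>x. 1 / s * S (x / s))"
    unfolding p_GSE_def[abs_def] GUE tau S_def s_def by (simp only: distrib_left)
  note dGUE = has_derivative_scaled[where A = "1 / s" and s = s, OF dG, folded GUE]
  note dGSE = has_derivative_scaled[where A = "1 / s" and s = s, OF dS, folded GSE]
  note dGSE1 = has_derivative_scaled[where A = "1 / s / s" and s = s, OF dS1]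
  note dGSE2 = has_derivative_scaled[where A = "1 / s / s / s" and s = s, OF dS2]
  have D1: "deriv (p_GSE n \<sigma>) = (\<lambda>x. 1 / s / s * S1 (x / s))"
    by (intro ext DERIV_imp_deriv dGSE)
  have D2: "deriv (deriv (p_GSE n \<sigma>)) = (\<lambda>x. 1 / s / s / s * S2 (x / s))"
    unfolding D1 by (intro ext DERIV_imp_deriv dGSE1)
  have D3: "(deriv ^^ 3) (p_GSE n \<sigma>) = (\<lambda>x. 1 / s / s / s / s * S3 (x / s))"
    unfolding numeral_3_eq_3 funpow.simps o_def id_def D2
    by (intro ext DERIV_imp_deriv dGSE2)
  have diff: "(deriv ^^ k) (p_GSE n \<sigma>) differentiable (at x)" if "k < 3" for k
  proof -
    consider "k = 0" | "k = 1" | "k = 2" using \<open>k < 3\<close> by linarith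
    then show ?thesis
    proof cases
      case 1 then show ?thesis using dGSE by (auto simp: real_differentiable_def)
    next
      case 2 then show ?thesis using dGSE1 by (auto simp: D1 real_differentiable_def)
    next
      case 3 then show ?thesis
        using dGSE2 by (auto simp: D2 numeral_2_eq_2 real_differentiable_def)
    qed
  qed
  define u where "u = x / s"
  have x: "x = s * u" using s by (simp add: u_def)
  have CD: "2 * G u = r\<^sup>2 * ((f u)\<^sup>2 + (g u)\<^sup>2) - 2 * r * u * f u * g u"
    unfolding G_def r_def f_def g_def by (rule christoffel_darboux_hermite_fun)
  \<comment> \<open>The terms in \<open>E\<close> cancel because
    \<open>f''' = (u\<^sup>2 + 1 - r\<^sup>2) * f' + 2 * u * f\<close>. Twice the remaining
    difference of the two sides is \<open>u\<close> times the defect in \<open>CD\<close>.\<close>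
  have main: "S3 u + (r\<^sup>2 - 1 - u\<^sup>2) * S1 u - 2 * u * S u
      = - (3 / 2) * (- r * f u * g u) - 3 * u * G u"
  proof -
    have "2 * (S3 u + (r\<^sup>2 - 1 - u\<^sup>2) * S1 u - 2 * u * S u
        - (- (3 / 2) * (- r * f u * g u) - 3 * u * G u))
        = u * (2 * G u - (r\<^sup>2 * ((f u)\<^sup>2 + (g u)\<^sup>2) - 2 * r * u * f u * g u))"
      unfolding S_def S1_def S3_def by (simp add: field_simps power2_eq_square)
    then show ?thesis using CD by simp
  qed
  \<comment> \<open>In terms of \<open>s\<close> and \<open>u\<close> each coefficient carries
    exactly the power of \<open>s\<close> that the chain rule and the prefactor \<open>1 / s\<close>
    put in the denominator.\<close>
  have s4: "4 * \<sigma> ^ 4 = s ^ 4"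
    using arg_cong[OF s(2), of "\<lambda>y. y\<^sup>2"] by (simp add: power_mult_distrib flip: power_mult)
  have coeff: "\<sigma>\<^sup>2 * (8 * real n + 2) - x\<^sup>2 = s\<^sup>2 * (r\<^sup>2 - 1 - u\<^sup>2)"
    unfolding r s x by (simp add: s power_mult_distrib algebra_simps)
  have "4 * \<sigma> ^ 4 * (deriv ^^ 3) (p_GSE n \<sigma>) x
      + (\<sigma>\<^sup>2 * (8 * real n + 2) - x\<^sup>2) * deriv (p_GSE n \<sigma>) x - 2 * x * p_GSE n \<sigma> x
      = S3 u + (r\<^sup>2 - 1 - u\<^sup>2) * S1 u - 2 * u * S u"
    unfolding s4 coeff D3 D1 unfolding GSE u_def[symmetric] using s(1)
    by (simp add: x power2_eq_square power4_eq_xxxx)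
  also have "\<dots> = - 3 * \<sigma>\<^sup>2 * deriv (p_GUE (2 * n + 1) \<sigma>) x - 3 * x * p_GUE (2 * n + 1) \<sigma> x"
  proof -
    \<comment> \<open>This half turns the coefficient \<open>- 3\<close> into the
      \<open>- (3 / 2)\<close> of \<open>main\<close>.\<close>
    have s2: "\<sigma>\<^sup>2 = s * s / 2" using s(2) by (simp add: power2_eq_square)
    have dG_x: "deriv (p_GUE (2 * n + 1) \<sigma>) x = 1 / s / s * (- r * f u * g u)"
      unfolding u_def by (rule DERIV_imp_deriv[OF dGUE])
    show ?thesis
      unfolding main s2 dG_x unfolding GUE u_def[symmetric] using s(1) by (simp add: x)
  qed
  finally show ?thesis
    using diff dGUE by (auto simp: real_differentiable_def)
qed

end
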